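(* A transverse Markov trace $(\tau_n)_{n\ge1}$ on $(H_n)_{n\ge1}$ is uniquely determined by the family of parameters $\{\tau_n(1)\}_{n\ge1}\subset R$, and is given recursively on the basis $\mathbf{b}^H_{n+1}$ of $H_{n+1}$ by $$\tau_{n+1}(u\sigma_k\sigma_{k-1}\cdots\sigma_i)=a\,\tau_n(u\sigma_{k-1}\cdots\sigma_i)$$ for $n\ge1$, $k=1,\dots,n$, $i=1,\dots,k$ and $u\in\mathbf{b}^H_k$ (where $\sigma_{k-1}\cdots\sigma_i=1$ if $i=k$).
   Context: Let $R=\mathbb{C}[a^{\pm1},q^{\pm1},(q-q^{-1})^{\pm1}]$. The Hecke algebra $H_n$ ($n\ge2$) is the $R$-algebra generated by $\sigma_1,\dots,\sigma_{n-1}$ with relations $\sigma_i\sigma_j=\sigma_j\sigma_i$ for $|i-j|\ge2$, $\sigma_i\sigma_{i+1}\sigma_i=\sigma_{i+1}\sigma_i\sigma_{i+1}$ for $1\le i\le n-2$, and $\sigma_i^2=1+(q-q^{-1})\sigma_i$ for $1\le i\le n-1$; $H_1=R$. The algebra $H_n$ is identified with its image in $H_{n+1}$ under the embedding $\sigma_i\mapsto\sigma_i$. The bases $\mathbf{b}^H_n$ of $H_n$ are defined by $\mathbf{b}^H_1=\{1\}$ and $\mathbf{b}^H_{n+1}=\{b,\ b\sigma_n\sigma_{n-1}\cdots\sigma_i\mid b\in\mathbf{b}^H_n,\ i=1,\dots,n\}$; equivalently $\mathbf{b}^H_{n+1}=\{1\}\cup\{u\sigma_k\sigma_{k-1}\cdots\sigma_i\mid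 k=1,\dots,n,\ i=1,\dots,k,\ u\in\mathbf{b}^H_k\}$. A transverse Markov trace on $(H_n)_{n\ge1}$ is a family $(\tau_n)_{n\ge1}$ of $R$-linear maps $\tau_n:H_n\to R$ such that, for all $n\ge1$ and $u,v\in H_n$: (trace property) $\tau_n(uv)=\tau_n(vu)$; (positive stabilization property) $\tau_{n+1}(u\sigma_nv)=a\,\tau_n(uv)$. *)

theory Defs
  imports
    "HOL-Computational_Algebra.Polynomial"
    "HOL-Computational_Algebra.Fraction_Field"
    "HOL-Library.Poly_Mapping"
    "HOL-Algebra.QuotRing"
begin

section \<open>The coefficient ring\<close>

text \<open>
  The ring \<open>R = \<complex>[a\<^sup>\<plusminus>\<^sup>1, q\<^sup>\<plusminus>\<^sup>1, (q - q\<^sup>-\<^sup>1)\<^sup>\<plusminus>\<^sup>1]\<close> is realised inside the field of rational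
  functions \<open>\<complex>(a, q)\<close>, which is \<open>Frac (\<complex>[a][q])\<close>.
\<close>

type_synonym ratfun = "complex poly poly fract"

definition ratfun_const :: "complex \<Rightarrow> ratfun"
  where "ratfun_const c = Fract [:[:c:]:] 1"

definition ratfun_a :: ratfun
  where "ratfun_a = Fract [:[:0, 1:]:] 1"

definition ratfun_q :: ratfun
  where "ratfun_q = Fract [:0, 1:] 1"

inductive_set coeff_ring_set :: "ratfun set"
  where
    const: "ratfun_const c \<in> coeff_ring_set"
  | a: "ratfun_a \<in> coeff_ring_set"
  | a_inv: "inverse ratfun_a \<in> coeff_ring_set"
  | q: "ratfun_q \<in> coeff_ring_set"
  | q_inv: "inverse ratfun_q \<in> coeff_ring_set"
  | qq_inv: "inverse (ratfun_q - inverse ratfun_q) \<in> coeff_ring_set"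
  | add: "x \<in> coeff_ring_set \<Longrightarrow> y \<in> coeff_ring_set \<Longrightarrow> x + y \<in> coeff_ring_set"
  | mult: "x \<in> coeff_ring_set \<Longrightarrow> y \<in> coeff_ring_set \<Longrightarrow> x * y \<in> coeff_ring_set"

lemma coeff_ring_set_0: "0 \<in> coeff_ring_set"
  using coeff_ring_set.const[of 0] by (simp add: ratfun_const_def fract_collapse)

lemma coeff_ring_set_1: "1 \<in> coeff_ring_set"
  using coeff_ring_set.const[of 1]
  by (simp add: ratfun_const_def fract_collapse flip: one_pCons)

lemma coeff_ring_set_uminus:
  assumes "x \<in> coeff_ring_set"
  shows "- x \<in> coeff_ring_set"
proof -
  have "ratfun_const (-1) = - 1"
    by (simp add: ratfun_const_def One_fract_def one_pCons)
  then have "- x = ratfun_const (-1) * x"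
    by simp
  then show ?thesis
    using assms by (metis coeff_ring_set.const coeff_ring_set.mult)
qed

lemma coeff_ring_set_diff:
  "x \<in> coeff_ring_set \<Longrightarrow> y \<in> coeff_ring_set \<Longrightarrow> x - y \<in> coeff_ring_set"
  using coeff_ring_set.add[of x "- y"] coeff_ring_set_uminus by simp

typedef coeff_ring = coeff_ring_set
  using coeff_ring_set_0 by blast

setup_lifting type_definition_coeff_ring

instantiation coeff_ring :: comm_ring_1
begin

lift_definition zero_coeff_ring :: coeff_ring is 0 by (rule coeff_ring_set_0)
lift_definition one_coeff_ring :: coeff_ring is 1 by (rule coeff_ring_set_1)
lift_definition plus_coeff_ring :: "coeff_ring \<Rightarrow> coeff_ring \<Rightarrow> coeff_ring" is "(+)"
  by (rule coeff_ring_set.add)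
lift_definition times_coeff_ring :: "coeff_ring \<Rightarrow> coeff_ring \<Rightarrow> coeff_ring" is "(*)"
  by (rule coeff_ring_set.mult)
lift_definition uminus_coeff_ring :: "coeff_ring \<Rightarrow> coeff_ring" is uminus
  by (rule coeff_ring_set_uminus)
lift_definition minus_coeff_ring :: "coeff_ring \<Rightarrow> coeff_ring \<Rightarrow> coeff_ring" is "(-)"
  by (rule coeff_ring_set_diff)

instance
  by standard (transfer; simp add: algebra_simps)+

end

lift_definition R_a :: coeff_ring is ratfun_a by (rule coeff_ring_set.a)
lift_definition R_q :: coeff_ring is ratfun_q by (rule coeff_ring_set.q)
lift_definition R_q_inv :: coeff_ring is "inverse ratfun_q" by (rule coeff_ring_set.q_inv)


section \<open>Free algebras\<close>

datatype fword = Word (letters: "nat list")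

instantiation fword :: monoid_add
begin

definition zero_fword :: fword where "0 = Word []"
definition plus_fword :: "fword \<Rightarrow> fword \<Rightarrow> fword"
  where "u + v = Word (letters u @ letters v)"

instance
  by standard (simp_all add: zero_fword_def plus_fword_def)

end

text \<open>
  Finitely supported functions on words with the convolution product: the free associative
  \<open>R\<close>-algebra on countably many generators.
\<close>

type_synonym falg = "fword \<Rightarrow>\<^sub>0 coeff_ring"

definition fgen :: "nat \<Rightarrow> falg"
  where "fgen i = Poly_Mapping.single (Word [i]) 1"

definition fconst :: "coeff_ring \<Rightarrow> falg"
  where "fconst r = Poly_Mapping.single 0 r"

text \<open>The free \<open>R\<close>-algebra on the generators with index \<open>1, \<dots>, n - 1\<close>.\<close>

definition free_alg :: "nat \<Rightarrow> falg ring"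
  where "free_alg n =
    \<lparr>carrier = {f. \<forall>w \<in> Poly_Mapping.keys f. set (letters w) \<subseteq> {1..<n}},
     mult = (*), one = 1, zero = 0, add = (+)\<rparr>"


section \<open>Hecke algebras\<close>

definition hecke_rels :: "nat \<Rightarrow> falg set"
  where "hecke_rels n =
    {fgen i * fgen j - fgen j * fgen i | i j.
        i \<in> {1..<n} \<and> j \<in> {1..<n} \<and> (i + 2 \<le> j \<or> j + 2 \<le> i)} \<union>
    {fgen i * fgen (i + 1) * fgen i - fgen (i + 1) * fgen i * fgen (i + 1) | i.
        1 \<le> i \<and> i + 1 < n} \<union>
    {fgen i * fgen i - (1 + fconst (R_q - R_q_inv) * fgen i) | i. i \<in> {1..<n}}"

definition hecke_ideal :: "nat \<Rightarrow> falg set"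
  where "hecke_ideal n = Idl\<^bsub>free_alg n\<^esub> (hecke_rels n)"

text \<open>For \<open>n = 1\<close> there are no generators and no relations, so this is (a copy of) \<open>R\<close>.\<close>

definition hecke :: "nat \<Rightarrow> falg set ring"
  where "hecke n = free_alg n Quot hecke_ideal n"

definition hecke_gen :: "nat \<Rightarrow> nat \<Rightarrow> falg set"
  where "hecke_gen n i = hecke_ideal n +>\<^bsub>free_alg n\<^esub> fgen i"

definition hecke_smult :: "nat \<Rightarrow> coeff_ring \<Rightarrow> falg set \<Rightarrow> falg set"
  where "hecke_smult n r x = (hecke_ideal n +>\<^bsub>free_alg n\<^esub> fconst r) \<otimes>\<^bsub>hecke n\<^esub> x"

text \<open>
  The map \<open>H\<^sub>m \<rightarrow> H\<^sub>n\<close>, \<open>\<sigma>\<^sub>i \<mapsto> \<sigma>\<^sub>i\<close>, for \<open>m \<le> n\<close>: the coset of \<open>f\<close> modulo the ideal of \<open>H\<^sub>m\<close> is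
  enlarged to the coset of \<open>f\<close> modulo the ideal of \<open>H\<^sub>n\<close> (see \<open>hecke_emb_coset\<close>). No
  reference to \<open>m\<close> is needed.
\<close>

definition hecke_emb :: "nat \<Rightarrow> falg set \<Rightarrow> falg set"
  where "hecke_emb n X = hecke_ideal n <+>\<^bsub>free_alg n\<^esub> X"

text \<open>
  The element \<open>\<sigma>\<^sub>k \<sigma>\<^sub>k\<^sub>-\<^sub>1 \<cdots> \<sigma>\<^sub>i\<close> of \<open>H\<^sub>n\<close>; it is \<open>1\<close> if \<open>i = k + 1\<close>.
\<close>

definition hecke_desc :: "nat \<Rightarrow> nat \<Rightarrow> nat \<Rightarrow> falg set"
  where "hecke_desc n k i =
    foldr (\<lambda>j x. hecke_gen n j \<otimes>\<^bsub>hecke n\<^esub> x) (rev [i..<Suc k]) \<one>\<^bsub>hecke n\<^esub>"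

text \<open>The value at \<open>0\<close> is a dummy.\<close>

fun hecke_basis :: "nat \<Rightarrow> falg set set"
  where
    "hecke_basis 0 = {}"
  | "hecke_basis (Suc 0) = {\<one>\<^bsub>hecke 1\<^esub>}"
  | "hecke_basis (Suc (Suc m)) = (let n = Suc m in
      {hecke_emb (n + 1) b | b. b \<in> hecke_basis n} \<union>
      {hecke_emb (n + 1) b \<otimes>\<^bsub>hecke (n + 1)\<^esub> hecke_desc (n + 1) n i | b i.
          b \<in> hecke_basis n \<and> i \<in> {1..n}})"

definition hecke_linear :: "nat \<Rightarrow> (falg set \<Rightarrow> coeff_ring) \<Rightarrow> bool"
  where "hecke_linear n t \<longleftrightarrow>
    (\<forall>x \<in> carrier (hecke n). \<forall>y \<in> carrier (hecke n). t (x \<oplus>\<^bsub>hecke n\<^esub> y) = t x + t y) \<and>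
    (\<forall>r. \<forall>x \<in> carrier (hecke n). t (hecke_smult n r x) = r * t x)"

text \<open>Only the values \<open>\<tau> n x\<close> with \<open>n \<ge> 1\<close> and \<open>x \<in> H\<^sub>n\<close> are meaningful.\<close>

definition transverse_markov_trace :: "(nat \<Rightarrow> falg set \<Rightarrow> coeff_ring) \<Rightarrow> bool"
  where "transverse_markov_trace \<tau> \<longleftrightarrow> (\<forall>n \<ge> 1.
    hecke_linear n (\<tau> n) \<and>
    (\<forall>u \<in> carrier (hecke n). \<forall>v \<in> carrier (hecke n).
      \<tau> n (u \<otimes>\<^bsub>hecke n\<^esub> v) = \<tau> n (v \<otimes>\<^bsub>hecke n\<^esub> u)) \<and>
    (\<forall>u \<in> carrier (hecke n). \<forall>v \<in> carrier (hecke n).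
      \<tau> (n + 1) (hecke_emb (n + 1) u \<otimes>\<^bsub>hecke (n + 1)\<^esub> hecke_gen (n + 1) n
                   \<otimes>\<^bsub>hecke (n + 1)\<^esub> hecke_emb (n + 1) v)
        = R_a * \<tau> n (u \<otimes>\<^bsub>hecke n\<^esub> v)))"


section \<open>Basic facts\<close>

lemma free_alg_simps [simp]:
  "mult (free_alg n) = (*)" "one (free_alg n) = 1" "zero (free_alg n) = 0"
  "add (free_alg n) = (+)"
  "f \<in> carrier (free_alg n) \<longleftrightarrow> (\<forall>w \<in> Poly_Mapping.keys f. set (letters w) \<subseteq> {1..<n})"
  by (simp_all add: free_alg_def)

lemma free_alg_uminus: "f \<in> carrier (free_alg n) \<Longrightarrow> - f \<in> carrier (free_alg n)"
  by (auto simp: in_keys_iff)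

lemma free_alg_add:
  "f \<in> carrier (free_alg n) \<Longrightarrow> g \<in> carrier (free_alg n) \<Longrightarrow> f + g \<in> carrier (free_alg n)"
  unfolding free_alg_simps using Poly_Mapping.keys_add[of f g] by blast

lemma free_alg_diff:
  assumes "f \<in> carrier (free_alg n)" "g \<in> carrier (free_alg n)"
  shows "f - g \<in> carrier (free_alg n)"
  using free_alg_add[OF assms(1) free_alg_uminus[OF assms(2)]] by simp

lemma free_alg_mult:
  assumes "f \<in> carrier (free_alg n)" "g \<in> carrier (free_alg n)"
  shows "f * g \<in> carrier (free_alg n)"
  unfolding free_alg_simps
proof
  fix w assume "w \<in> Poly_Mapping.keys (f * g)"
  then obtain u v where "u \<in> Poly_Mapping.keys f" "v \<in> Poly_Mapping.keys g" "w = u + v"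
    using Poly_Mapping.keys_mult[of f g] by blast
  then show "set (letters w) \<subseteq> {1..<n}"
    using assms by (auto simp: plus_fword_def)
qed

lemma free_alg_one: "1 \<in> carrier (free_alg n)"
  by (auto simp: zero_fword_def simp flip: single_one split: if_splits)

lemma fgen_closed: "i \<in> {1..<n} \<Longrightarrow> fgen i \<in> carrier (free_alg n)"
  by (simp add: fgen_def)

lemma fconst_closed: "fconst r \<in> carrier (free_alg n)"
  by (simp add: fconst_def zero_fword_def)

lemma free_alg_ring: "ring (free_alg n)"
proof (rule ringI)
  show "abelian_group (free_alg n)"
  proof (rule abelian_groupI)
    fix f assume "f \<in> carrier (free_alg n)"
    then show "\<exists>g \<in> carrier (free_alg n). g \<oplus>\<^bsub>free_alg n\<^esub> f = \<zero>\<^bsub>free_alg n\<^esub>"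
      using free_alg_uminus by (intro bexI[of _ "- f"]) auto
  qed (use free_alg_add in \<open>auto simp del: free_alg_simps(5) simp: add_ac\<close>, simp)
  show "Group.monoid (free_alg n)"
    by (rule monoidI)
      (use free_alg_mult free_alg_one in \<open>auto simp del: free_alg_simps(5) simp: mult.assoc\<close>)
qed (simp_all add: algebra_simps)

lemma hecke_rels_closed: "hecke_rels n \<subseteq> carrier (free_alg n)"
  unfolding hecke_rels_def
  by (auto simp del: free_alg_simps(5)
      intro!: free_alg_diff free_alg_mult free_alg_add free_alg_one fgen_closed fconst_closed)

lemma hecke_ideal_is_ideal: "ideal (hecke_ideal n) (free_alg n)"
  unfolding hecke_ideal_def by (rule ring.genideal_ideal[OF free_alg_ring hecke_rels_closed])

lemma hecke_is_ring: "ring (hecke n)"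
  unfolding hecke_def by (rule ideal.quotient_is_ring[OF hecke_ideal_is_ideal])

lemma free_alg_mono: "m \<le> n \<Longrightarrow> carrier (free_alg m) \<subseteq> carrier (free_alg n)"
  by (fastforce simp: subset_iff)

lemma free_alg_a_inv:
  assumes "f \<in> carrier (free_alg n)"
  shows "\<ominus>\<^bsub>free_alg n\<^esub> f = - f"
proof -
  interpret ring "free_alg n" by (rule free_alg_ring)
  show ?thesis
    by (rule minus_equality) (use assms free_alg_uminus[OF assms] in simp_all)
qed

lemma hecke_ideal_mono:
  assumes "m \<le> n"
  shows "hecke_ideal m \<subseteq> hecke_ideal n"
proof -
  interpret N: ideal "hecke_ideal n" "free_alg n" by (rule hecke_ideal_is_ideal)
  interpret M: ring "free_alg m" by (rule free_alg_ring)
  let ?J = "hecke_ideal n \<inter> carrier (free_alg m)"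
  have mn: "f \<in> carrier (free_alg n)" if "f \<in> carrier (free_alg m)" for f
    using free_alg_mono[OF assms] that by blast
  have "ideal ?J (free_alg m)"
  proof (rule idealI)
    show "ring (free_alg m)" by (rule free_alg_ring)
    show "subgroup ?J (add_monoid (free_alg m))"
    proof (rule M.add.subgroupI)
      show "?J \<subseteq> carrier (free_alg m)"
        by blast
      show "?J \<noteq> {}"
        using additive_subgroup.zero_closed[OF N.additive_subgroup_axioms] M.zero_closed
        by fastforce
      fix f assume f: "f \<in> ?J"
      then have "- f \<in> hecke_ideal n"
        using N.I_l_closed[of f "- 1"] free_alg_uminus[OF free_alg_one, of n]
        by (simp del: free_alg_simps(5))
      then show "\<ominus>\<^bsub>free_alg m\<^esub> f \<in> ?J"
        using f free_alg_uminus[of f m] free_alg_a_inv[of f m] by auto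
      fix g assume g: "g \<in> ?J"
      have "f + g \<in> hecke_ideal n"
        using additive_subgroup.a_closed[OF N.additive_subgroup_axioms, of f g] f g by simp
      then show "f \<oplus>\<^bsub>free_alg m\<^esub> g \<in> ?J"
        using f g free_alg_add[of f m g] by (simp del: free_alg_simps(5))
    qed
  next
    fix f g assume fg: "f \<in> ?J" "g \<in> carrier (free_alg m)"
    show "g \<otimes>\<^bsub>free_alg m\<^esub> f \<in> ?J"
      using fg N.I_l_closed[of f g] mn[of g] free_alg_mult[of g m f]
      by (simp del: free_alg_simps(5))
    show "f \<otimes>\<^bsub>free_alg m\<^esub> g \<in> ?J"
      using fg N.I_r_closed[of f g] mn[of g] free_alg_mult[of f m g]
      by (simp del: free_alg_simps(5))
  qed
  moreover have "hecke_rels m \<subseteq> ?J"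
  proof -
    have "hecke_rels m \<subseteq> hecke_rels n"
      using assms unfolding hecke_rels_def by fastforce
    also have "\<dots> \<subseteq> hecke_ideal n"
      unfolding hecke_ideal_def by (rule N.genideal_self[OF hecke_rels_closed])
    finally show ?thesis
      using hecke_rels_closed by blast
  qed
  ultimately show ?thesis
    unfolding hecke_ideal_def[of m] using M.genideal_minimal by blast
qed

lemma hecke_emb_coset:
  assumes "m \<le> n" "f \<in> carrier (free_alg m)"
  shows "hecke_emb n (hecke_ideal m +>\<^bsub>free_alg m\<^esub> f) = hecke_ideal n +>\<^bsub>free_alg n\<^esub> f"
proof -
  interpret N: ideal "hecke_ideal n" "free_alg n" by (rule hecke_ideal_is_ideal)
  interpret M: ideal "hecke_ideal m" "free_alg m" by (rule hecke_ideal_is_ideal)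
  have coset: "hecke_ideal k +>\<^bsub>free_alg k\<^esub> f = {x + f | x. x \<in> hecke_ideal k}" for k
    by (auto simp: a_r_coset_def')
  have closed: "x + y \<in> hecke_ideal n" if "x \<in> hecke_ideal n" "y \<in> hecke_ideal m" for x y
    using additive_subgroup.a_closed[OF N.additive_subgroup_axioms, of x y] that hecke_ideal_mono[OF assms(1)] by auto
  have zero: "0 \<in> hecke_ideal m"
    using additive_subgroup.zero_closed[OF M.additive_subgroup_axioms] by simp
  have "hecke_emb n (hecke_ideal m +>\<^bsub>free_alg m\<^esub> f)
      = {x + (y + f) | x y. x \<in> hecke_ideal n \<and> y \<in> hecke_ideal m}"
    unfolding hecke_emb_def coset by (auto simp: set_add_def')
  also have "\<dots> = {x + f | x. x \<in> hecke_ideal n}"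
  proof (intro subset_antisym subsetI)
    fix z assume "z \<in> {x + (y + f) | x y. x \<in> hecke_ideal n \<and> y \<in> hecke_ideal m}"
    then obtain x y where "z = (x + y) + f" "x \<in> hecke_ideal n" "y \<in> hecke_ideal m"
      by (auto simp: add.assoc)
    then show "z \<in> {x + f | x. x \<in> hecke_ideal n}"
      using closed by blast
  next
    fix z assume "z \<in> {x + f | x. x \<in> hecke_ideal n}"
    then obtain x where "z = x + (0 + f)" "x \<in> hecke_ideal n"
      by auto
    then show "z \<in> {x + (y + f) | x y. x \<in> hecke_ideal n \<and> y \<in> hecke_ideal m}"
      using zero by blast
  qed
  finally show ?thesis
    unfolding coset .
qed

end

theory Submission
  imports Defs
begin

text \<open>
  Everything is computed in the free algebra modulo the Hecke ideal. The key identity is that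
  stabilization holds for every crossing, not only for the last one:
  \<open>\<tau>\<^sub>n\<^sub>+\<^sub>1 (u \<sigma>\<^sub>j v) = a \<tau>\<^sub>n (u v)\<close> for \<open>1 \<le> j \<le> n\<close> and \<open>u, v \<in> H\<^sub>j\<close>. This goes by downward induction on
  \<open>j\<close>: conjugating by \<open>\<sigma>\<^sub>j\<^sub>+\<^sub>1\<close>, which commutes with \<open>u\<close> and \<open>v\<close>, turns \<open>u \<sigma>\<^sub>j v\<close> into
  \<open>(u \<sigma>\<^sub>j) \<sigma>\<^sub>j\<^sub>+\<^sub>1 (\<sigma>\<^sub>j\<^sup>-\<^sup>1 v)\<close>. It contains the recursion formula, and it gives uniqueness because
  \<open>H\<^sub>n\<close> is spanned by \<open>1\<close> and the elements \<open>u \<sigma>\<^sub>j v\<close> with \<open>j < n\<close> and \<open>u, v \<in> H\<^sub>j\<close>.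
\<close>

section \<open>Computing modulo the Hecke ideal\<close>

abbreviation hecke_class :: "nat \<Rightarrow> falg \<Rightarrow> falg set"
  where "hecke_class n f \<equiv> hecke_ideal n +>\<^bsub>free_alg n\<^esub> f"

declare free_alg_simps(5) [simp del]

section \<open>Monomials of the free algebra\<close>

lemma falg_eq_sum_singles:
  "f = (\<Sum>w\<in>Poly_Mapping.keys f. Poly_Mapping.single w (Poly_Mapping.lookup f w))" for f :: falg
  by (rule poly_mapping_eqI) (simp add: lookup_sum lookup_single when_def in_keys_iff)

lemma fconst_commute: "f * fconst r = fconst r * f"
proof -
  have "Poly_Mapping.single w c * fconst r = fconst r * Poly_Mapping.single w c" for w c
    by (simp add: fconst_def mult_single mult.commute)
  then show ?thesis
    by (subst (1 2) falg_eq_sum_singles[of f])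
      (simp only: sum_distrib_left sum_distrib_right)
qed

text \<open>Scaling needs no case of its own: the coefficient of a monomial is the constant at its
  right end, and the letters are prepended one at a time.\<close>

lemma free_alg_induct [consumes 1, case_names const add gen]:
  assumes "f \<in> carrier (free_alg n)"
    and const: "\<And>c. P (fconst c)"
    and add: "\<And>f g. f \<in> carrier (free_alg n) \<Longrightarrow> g \<in> carrier (free_alg n) \<Longrightarrow>
      P f \<Longrightarrow> P g \<Longrightarrow> P (f + g)"
    and gen: "\<And>i f. i \<in> {1..<n} \<Longrightarrow> f \<in> carrier (free_alg n) \<Longrightarrow> P f \<Longrightarrow> P (fgen i * f)"
  shows "P f"
proof -
  have word: "Poly_Mapping.single (Word l) c \<in> carrier (free_alg n) \<and>
      P (Poly_Mapping.single (Word l) c)"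
    if "set l \<subseteq> {1..<n}" for l c
    using that
  proof (induction l)
    case Nil
    then show ?case
      using const[of c] fconst_closed[of c n] by (simp add: fconst_def zero_fword_def)
  next
    case (Cons i l)
    have "Poly_Mapping.single (Word (i # l)) c = fgen i * Poly_Mapping.single (Word l) c"
      by (simp add: fgen_def mult_single plus_fword_def)
    then show ?case
      using Cons gen fgen_closed free_alg_mult by simp
  qed
  have "(\<Sum>w\<in>A. Poly_Mapping.single w (Poly_Mapping.lookup f w)) \<in> carrier (free_alg n) \<and>
      P (\<Sum>w\<in>A. Poly_Mapping.single w (Poly_Mapping.lookup f w))"
    if "finite A" "A \<subseteq> Poly_Mapping.keys f" for A
    using that
  proof (induction A rule: finite_induct)
    case empty
    then show ?case
      using const[of 0] fconst_closed[of 0 n] by (simp add: fconst_def)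
  next
    case (insert w A)
    have "set (letters w) \<subseteq> {1..<n}"
      using assms(1) insert.prems by (simp add: free_alg_simps(5))
    then show ?case
      using insert word[of "letters w"] add free_alg_add by simp
  qed
  from this[of "Poly_Mapping.keys f"] show ?thesis
    using falg_eq_sum_singles[of f] by simp
qed

section \<open>Membership in the Hecke ideal\<close>

lemma hecke_ideal_closed: "x \<in> hecke_ideal n \<Longrightarrow> x \<in> carrier (free_alg n)"
  using ideal.Icarr[OF hecke_ideal_is_ideal] by blast

lemma hecke_ideal_add: "x \<in> hecke_ideal n \<Longrightarrow> y \<in> hecke_ideal n \<Longrightarrow> x + y \<in> hecke_ideal n"
  using additive_subgroup.a_closed[OF ideal.axioms(1)[OF hecke_ideal_is_ideal], of x n y] by simp

lemma hecke_ideal_zero: "0 \<in> hecke_ideal n"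
  using additive_subgroup.zero_closed[OF ideal.axioms(1)[OF hecke_ideal_is_ideal], of n] by simp

lemma hecke_ideal_mult_left:
  "x \<in> hecke_ideal n \<Longrightarrow> f \<in> carrier (free_alg n) \<Longrightarrow> f * x \<in> hecke_ideal n"
  using ideal.I_l_closed[OF hecke_ideal_is_ideal, of x n f] by simp

lemma hecke_ideal_mult_right:
  "x \<in> hecke_ideal n \<Longrightarrow> f \<in> carrier (free_alg n) \<Longrightarrow> x * f \<in> hecke_ideal n"
  using ideal.I_r_closed[OF hecke_ideal_is_ideal, of x n f] by simp

lemma hecke_ideal_mult:
  "x \<in> hecke_ideal n \<Longrightarrow> f \<in> carrier (free_alg n) \<Longrightarrow> g \<in> carrier (free_alg n) \<Longrightarrow>
    f * x * g \<in> hecke_ideal n"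
  by (intro hecke_ideal_mult_left hecke_ideal_mult_right)

lemma hecke_ideal_uminus: "x \<in> hecke_ideal n \<Longrightarrow> - x \<in> hecke_ideal n"
  using hecke_ideal_mult_left[of x n "- 1"] free_alg_uminus[OF free_alg_one] by simp

lemma hecke_rels_in_ideal: "x \<in> hecke_rels n \<Longrightarrow> x \<in> hecke_ideal n"
  unfolding hecke_ideal_def using ring.genideal_self[OF free_alg_ring hecke_rels_closed] by blast

section \<open>Residue classes and the operations of the Hecke algebra\<close>

lemma hecke_class_eqI:
  assumes "f - g \<in> hecke_ideal n"
  shows "hecke_class n f = hecke_class n g"
proof -
  have "{x + f | x. x \<in> hecke_ideal n} \<subseteq> {x + g | x. x \<in> hecke_ideal n}"
    if "f - g \<in> hecke_ideal n" for f g
  proof clarify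
    fix x assume "x \<in> hecke_ideal n"
    then have "x + (f - g) \<in> hecke_ideal n" using that by (rule hecke_ideal_add)
    moreover have "x + f = x + (f - g) + g" by simp
    ultimately show "\<exists>x'. x + f = x' + g \<and> x' \<in> hecke_ideal n" by blast
  qed
  from this[of f g] this[of g f] show ?thesis
    using assms hecke_ideal_uminus[OF assms] by (auto simp: a_r_coset_def')
qed

lemma hecke_class_mult:
  "f \<in> carrier (free_alg n) \<Longrightarrow> g \<in> carrier (free_alg n) \<Longrightarrow>
    hecke_class n f \<otimes>\<^bsub>hecke n\<^esub> hecke_class n g = hecke_class n (f * g)"
  using ideal.rcoset_mult_add[OF hecke_ideal_is_ideal, of f n g]
  by (simp add: hecke_def FactRing_def)

lemma hecke_class_add:
  "f \<in> carrier (free_alg n) \<Longrightarrow> g \<in> carrier (free_alg n) \<Longrightarrow>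
    hecke_class n f \<oplus>\<^bsub>hecke n\<^esub> hecke_class n g = hecke_class n (f + g)"
  using abelian_subgroup.a_rcos_sum
    [OF ideal.axioms(1)[OF hecke_ideal_is_ideal, THEN abelian_subgroupI3
        [OF _ ring.is_abelian_group[OF free_alg_ring]]], of f n g]
  by (simp add: hecke_def FactRing_def)

lemma hecke_one: "\<one>\<^bsub>hecke n\<^esub> = hecke_class n 1"
  by (simp add: hecke_def FactRing_def)

lemma hecke_class_closed: "f \<in> carrier (free_alg n) \<Longrightarrow> hecke_class n f \<in> carrier (hecke n)"
  by (auto simp: hecke_def FactRing_def A_RCOSETS_def')

lemma hecke_carrierE:
  assumes "x \<in> carrier (hecke n)"
  obtains f where "f \<in> carrier (free_alg n)" "x = hecke_class n f"
  using assms by (auto simp: hecke_def FactRing_def A_RCOSETS_def')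

section \<open>The defining relations modulo the ideal\<close>

lemma hecke_quadratic:
  assumes "i \<in> {1..<n}"
  shows "fgen i * fgen i - (1 + fconst (R_q - R_q_inv) * fgen i) \<in> hecke_ideal n"
  by (rule hecke_rels_in_ideal) (use assms in \<open>auto simp: hecke_rels_def\<close>)

lemma hecke_braid:
  assumes "1 \<le> i" "i + 1 < n"
  shows "fgen i * fgen (i + 1) * fgen i - fgen (i + 1) * fgen i * fgen (i + 1) \<in> hecke_ideal n"
  by (rule hecke_rels_in_ideal) (use assms in \<open>auto simp: hecke_rels_def\<close>)

text \<open>Every letter of \<open>f\<close> has index at most \<open>j - 1\<close>, hence at most
  \<open>i - 2\<close>, so \<open>fgen i\<close> passes it by a far commutation relation.\<close>

lemma hecke_far_commute:
  assumes "f \<in> carrier (free_alg j)" "j < i" "i < n"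
  shows "fgen i * f - f * fgen i \<in> hecke_ideal n"
  using assms(1)
proof (induction f rule: free_alg_induct)
  case (const c)
  then show ?case by (simp add: fconst_commute hecke_ideal_zero)
next
  case (add f g)
  have "fgen i * (f + g) - (f + g) * fgen i = (fgen i * f - f * fgen i) + (fgen i * g - g * fgen i)"
    by (simp add: algebra_simps)
  then show ?case using add hecke_ideal_add by simp
next
  case (gen l f)
  have l: "l \<in> {1..<n}" and f: "f \<in> carrier (free_alg n)"
    using gen assms free_alg_mono[of j n] by auto
  have "fgen i * fgen l - fgen l * fgen i \<in> hecke_ideal n"
    using l gen assms
    by (intro hecke_rels_in_ideal, unfold hecke_rels_def)
      (intro UnI1 CollectI exI[of _ i] exI[of _ l], auto)
  \<comment> \<open>Leibniz rule for the commutator with \<open>fgen i\<close>.\<close>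
  then have "(fgen i * fgen l - fgen l * fgen i) * f + fgen l * (fgen i * f - f * fgen i) \<in> hecke_ideal n"
    using gen l f
    by (intro hecke_ideal_add hecke_ideal_mult_left hecke_ideal_mult_right fgen_closed)
  then show ?case by (simp add: algebra_simps)
qed


section \<open>A spanning set\<close>

text \<open>A crossing contains its largest letter \<open>fgen j\<close> exactly once, the shape
  that stabilization evaluates. Scalars are absorbed into \<open>f\<close>.\<close>

inductive_set hecke_span :: "nat \<Rightarrow> falg set" for n :: nat
  where
    const: "fconst c \<in> hecke_span n"
  | crossing: "1 \<le> j \<Longrightarrow> j < n \<Longrightarrow> f \<in> carrier (free_alg j) \<Longrightarrow> g \<in> carrier (free_alg j) \<Longrightarrow>
      f * fgen j * g \<in> hecke_span n"
  | ideal: "x \<in> hecke_ideal n \<Longrightarrow> x \<in> hecke_span n"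
  | add: "x \<in> hecke_span n \<Longrightarrow> y \<in> hecke_span n \<Longrightarrow> x + y \<in> hecke_span n"

lemma crossing_closed:
  assumes "1 \<le> j" "j < n" "f \<in> carrier (free_alg j)" "g \<in> carrier (free_alg j)"
  shows "f * fgen j * g \<in> carrier (free_alg n)"
  using assms free_alg_mono[of j n] by (auto intro!: free_alg_mult fgen_closed)

lemma hecke_span_closed: "x \<in> hecke_span n \<Longrightarrow> x \<in> carrier (free_alg n)"
  by (induction rule: hecke_span.induct)
    (auto intro: fconst_closed crossing_closed hecke_ideal_closed free_alg_add)

lemma hecke_span_cong: "y \<in> hecke_span n \<Longrightarrow> x - y \<in> hecke_ideal n \<Longrightarrow> x \<in> hecke_span n"
  using hecke_span.add[OF hecke_span.ideal, of "x - y" n y] by simp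

text \<open>All four rules persist from \<open>m\<close> to \<open>n\<close>, the ideal by
  \<open>hecke_ideal_mono\<close>. The last hypothesis is the spanning theorem at level
  \<open>m\<close>.\<close>

lemma hecke_span_free:
  assumes "f \<in> carrier (free_alg m)" "m < n" "carrier (free_alg m) \<subseteq> hecke_span m"
  shows "f \<in> hecke_span n"
proof -
  have "f \<in> hecke_span m" using assms by blast
  then show ?thesis
    by (induction rule: hecke_span.induct)
      (use assms(2) hecke_ideal_mono[of m n] in \<open>auto intro: hecke_span.intros\<close>)
qed

text \<open>The hard case of the spanning theorem: two copies of the largest letter must merge. If
  \<open>x\<close> commutes with \<open>fgen j\<close>, the quadratic relation does it; if
  \<open>x\<close> is a crossing at \<open>j - 1\<close>, the braid relation does.\<close>

lemma hecke_span_double_crossing: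
  assumes "x \<in> hecke_span j" "1 \<le> j" "j < n" "g \<in> carrier (free_alg j)"
    and IH: "carrier (free_alg j) \<subseteq> hecke_span j"
  shows "fgen j * x * fgen j * g \<in> hecke_span n"
proof -
  have jn: "f \<in> carrier (free_alg n)" if "f \<in> carrier (free_alg j)" for f
    using that assms free_alg_mono[of j n] by auto
  define z where "z = fconst (R_q - R_q_inv)"
  have sj: "fgen j \<in> carrier (free_alg n)" using assms by (intro fgen_closed) auto
  \<comment> \<open>Moving \<open>f\<close> to the left leaves a square of \<open>fgen j\<close>, so
    the product is congruent to \<open>f * g + f * z * fgen j * g\<close>; here \<open>f * g\<close>
    belongs to a lower level.\<close>
  have far: "fgen j * f * fgen j * g \<in> hecke_span n"
    if f: "f \<in> carrier (free_alg j)" and c: "fgen j * f - f * fgen j \<in> hecke_ideal n" for f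
  proof (rule hecke_span_cong)
    have fz: "f * z \<in> carrier (free_alg j)"
      using f by (auto simp: z_def intro: free_alg_mult fconst_closed)
    show "f * g + (f * z) * fgen j * g \<in> hecke_span n"
      using f fz assms free_alg_mult[of f j g]
      by (intro hecke_span.add hecke_span_free[of "f * g" j] hecke_span.crossing)
    have "(fgen j * f - f * fgen j) * (fgen j * g) + f * (fgen j * fgen j - (1 + z * fgen j)) * g
        \<in> hecke_ideal n"
      unfolding z_def using c assms sj jn[OF f] jn[OF assms(4)]
      by (intro hecke_ideal_add hecke_ideal_mult hecke_ideal_mult_right hecke_quadratic free_alg_mult) auto
    then show "fgen j * f * fgen j * g - (f * g + (f * z) * fgen j * g) \<in> hecke_ideal n"
      by (simp add: algebra_simps)
  qed
  show ?thesis
    using assms(1)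
  proof (induction rule: hecke_span.induct)
    case (const c)
    show ?case
      by (rule far) (simp_all add: fconst_closed fconst_commute hecke_ideal_zero)
  next
    case (crossing l u v)
    show ?case
    proof (cases "l + 1 = j")
      case False
      have "u * fgen l * v \<in> carrier (free_alg (l + 1))"
        using crossing by (intro crossing_closed) auto
      then show ?thesis
        using crossing False assms hecke_far_commute[of _ "l + 1" j n] free_alg_mono[of "l + 1" j]
        by (intro far) auto
    next
      case True
      \<comment> \<open>The letters of \<open>u\<close> and \<open>v\<close> are below
        \<open>l = j - 1\<close>, so both commute with \<open>?r\<close>. The two copies of
        \<open>?r\<close> close in around \<open>?s\<close>, and \<open>?r * ?s * ?r\<close> becomes
        \<open>?s * ?r * ?s\<close>.\<close>
      let ?s = "fgen l" and ?r = "fgen j"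
      have closed: "u \<in> carrier (free_alg j)" "v \<in> carrier (free_alg j)" "?s \<in> carrier (free_alg j)"
        using crossing free_alg_mono[of l j] by (auto intro: fgen_closed)
      have comm: "?r * u - u * ?r \<in> hecke_ideal n" "?r * v - v * ?r \<in> hecke_ideal n"
        using crossing assms by (auto intro: hecke_far_commute)
      have braid: "?s * ?r * ?s - ?r * ?s * ?r \<in> hecke_ideal n"
        using hecke_braid[of l n] crossing True assms by auto
      show ?thesis
      proof (rule hecke_span_cong)
        show "(u * ?s) * ?r * (?s * v * g) \<in> hecke_span n"
          using closed assms by (intro hecke_span.crossing free_alg_mult) auto
        have "(?r * u - u * ?r) * (?s * v * ?r * g) + - ((u * ?r * ?s) * (?r * v - v * ?r) * g)
            + - (u * (?s * ?r * ?s - ?r * ?s * ?r) * (v * g)) \<in> hecke_ideal n"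
          using comm braid sj closed[THEN jn] jn[OF assms(4)]
          by (intro hecke_ideal_add hecke_ideal_uminus hecke_ideal_mult hecke_ideal_mult_right
              free_alg_mult)
        then show "?r * (u * ?s * v) * ?r * g - (u * ?s) * ?r * (?s * v * g) \<in> hecke_ideal n"
          by (simp add: algebra_simps)
      qed
    qed
  next
    case (ideal x)
    then have "x \<in> hecke_ideal n" using hecke_ideal_mono[of j n] assms by auto
    then have "fgen j * x * (fgen j * g) \<in> hecke_ideal n"
      using assms sj jn by (intro hecke_ideal_mult free_alg_mult) auto
    then show ?case by (auto intro: hecke_span.ideal simp: mult.assoc)
  next
    case (add x y)
    then show ?case using hecke_span.add by (simp add: algebra_simps)
  qed
qed

text \<open>Compare \<open>i\<close> with the largest letter of a crossing: smaller, it is absorbed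
  into the left factor; equal, the two copies merge; larger, it becomes the new largest letter, with
  the old crossing as right factor.\<close>

lemma hecke_span_gen:
  assumes "x \<in> hecke_span n" "i \<in> {1..<n}"
    and IH: "\<And>m. m < n \<Longrightarrow> carrier (free_alg m) \<subseteq> hecke_span m"
  shows "fgen i * x \<in> hecke_span n"
  using assms(1)
proof (induction rule: hecke_span.induct)
  case (const c)
  show ?case
    using hecke_span.crossing[of i n 1 "fconst c"] assms free_alg_one fconst_closed by auto
next
  case (crossing j f g)
  consider "i < j" | "i = j" | "j < i" by linarith
  then show ?case
  proof cases
    case 1
    then have "fgen i * f \<in> carrier (free_alg j)"
      using crossing assms by (intro free_alg_mult fgen_closed) auto
    then show ?thesis
      using hecke_span.crossing[of j n "fgen i * f" g] crossing by (simp add: mult.assoc)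
  next
    case 2
    then show ?thesis
      using hecke_span_double_crossing[of f j n g] crossing IH[of j] by (auto simp: mult.assoc)
  next
    case 3
    then have "f * fgen j * g \<in> carrier (free_alg i)"
      using crossing by (intro crossing_closed)
    then show ?thesis
      using hecke_span.crossing[of i n 1 "f * fgen j * g"] assms free_alg_one by auto
  qed
next
  case (ideal x)
  then show ?case
    using assms by (intro hecke_span.ideal hecke_ideal_mult_left fgen_closed)
next
  case (add x y)
  then show ?case using hecke_span.add by (simp add: algebra_simps)
qed

lemma free_alg_subset_hecke_span: "carrier (free_alg n) \<subseteq> hecke_span n"
proof (induction n rule: less_induct)
  case (less n)
  show ?case
  proof
    fix f assume "f \<in> carrier (free_alg n)"
    then show "f \<in> hecke_span n"
      by (induction f rule: free_alg_induct)
        (use less hecke_span_gen in \<open>auto intro: hecke_span.const hecke_span.add\<close>)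
  qed
qed


section \<open>Markov traces on the free algebras\<close>

locale markov_trace =
  fixes \<tau> :: "nat \<Rightarrow> falg set \<Rightarrow> coeff_ring"
  assumes transverse: "transverse_markov_trace \<tau>"
begin

text \<open>On representatives, identities of the Hecke algebra become ring arithmetic plus ideal
  membership, via \<open>ftrace_cong\<close>.\<close>

definition ftrace :: "nat \<Rightarrow> falg \<Rightarrow> coeff_ring"
  where "ftrace n f = \<tau> n (hecke_class n f)"

lemma ftrace_cong: "f - g \<in> hecke_ideal n \<Longrightarrow> ftrace n f = ftrace n g"
  unfolding ftrace_def using hecke_class_eqI by metis

lemma ftrace_add:
  assumes "n \<ge> 1" "f \<in> carrier (free_alg n)" "g \<in> carrier (free_alg n)"
  shows "ftrace n (f + g) = ftrace n f + ftrace n g"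
  using transverse assms
  by (simp add: ftrace_def transverse_markov_trace_def hecke_linear_def hecke_class_closed
      flip: hecke_class_add)

lemma ftrace_const:
  assumes "n \<ge> 1"
  shows "ftrace n (fconst c) = c * \<tau> n \<one>\<^bsub>hecke n\<^esub>"
proof -
  have "hecke_smult n c \<one>\<^bsub>hecke n\<^esub> = hecke_class n (fconst c)"
    by (simp add: hecke_smult_def hecke_one hecke_class_mult fconst_closed free_alg_one)
  moreover have "\<tau> n (hecke_smult n c \<one>\<^bsub>hecke n\<^esub>) = c * \<tau> n \<one>\<^bsub>hecke n\<^esub>"
    using transverse assms hecke_class_closed[OF free_alg_one, of n]
    by (simp add: transverse_markov_trace_def hecke_linear_def hecke_one)
  ultimately show ?thesis by (simp add: ftrace_def)
qed

lemma ftrace_commute: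
  assumes "n \<ge> 1" "f \<in> carrier (free_alg n)" "g \<in> carrier (free_alg n)"
  shows "ftrace n (f * g) = ftrace n (g * f)"
  using transverse assms
  by (simp add: ftrace_def transverse_markov_trace_def hecke_class_closed flip: hecke_class_mult)

lemma ftrace_stabilization_last:
  assumes "n \<ge> 1" "f \<in> carrier (free_alg n)" "g \<in> carrier (free_alg n)"
  shows "ftrace (n + 1) (f * fgen n * g) = R_a * ftrace n (f * g)"
proof -
  have "f \<in> carrier (free_alg (n + 1))" "g \<in> carrier (free_alg (n + 1))"
    "fgen n \<in> carrier (free_alg (n + 1))"
    using assms free_alg_mono[of n "n + 1"] by (auto intro: fgen_closed)
  then have "hecke_class (n + 1) (f * fgen n * g) =
      hecke_emb (n + 1) (hecke_class n f) \<otimes>\<^bsub>hecke (n + 1)\<^esub> hecke_gen (n + 1) n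
        \<otimes>\<^bsub>hecke (n + 1)\<^esub> hecke_emb (n + 1) (hecke_class n g)"
    using assms by (simp add: hecke_emb_coset hecke_gen_def hecke_class_mult free_alg_mult)
  then show ?thesis
    using transverse assms
    by (simp add: ftrace_def transverse_markov_trace_def hecke_class_closed flip: hecke_class_mult)
qed

text \<open>By the quadratic relation, \<open>?r'\<close> and \<open>?s'\<close> below are the
  inverses of \<open>?r\<close> and \<open>?s\<close>. Conjugation by \<open>?r\<close> preserves
  the trace and gives \<open>f * (?r' * ?s * ?r) * g\<close>; the braid relation turns the bracket
  into \<open>?s * ?r * ?s'\<close>.\<close>

lemma ftrace_shift_crossing:
  assumes "1 \<le> j" "j + 1 < n" "f \<in> carrier (free_alg j)" "g \<in> carrier (free_alg j)"
  shows "ftrace n (f * fgen j * g) =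
    ftrace n ((f * fgen j) * fgen (j + 1) * ((fgen j - fconst (R_q - R_q_inv)) * g))"
proof -
  define z where "z = fconst (R_q - R_q_inv)"
  let ?s = "fgen j" and ?r = "fgen (j + 1)"
  let ?r' = "?r - z" and ?s' = "?s - z"
  have zc: "x * z = z * x" for x
    by (simp add: z_def fconst_commute)
  have cl: "f \<in> carrier (free_alg n)" "g \<in> carrier (free_alg n)" "?s \<in> carrier (free_alg n)"
    "?r \<in> carrier (free_alg n)" "z \<in> carrier (free_alg n)"
    using assms free_alg_mono[of j n] by (auto simp: z_def intro: fgen_closed fconst_closed)
  note cl = cl free_alg_mult free_alg_diff
  have far: "?r * f - f * ?r \<in> hecke_ideal n" "?r * g - g * ?r \<in> hecke_ideal n"
    using assms by (auto intro: hecke_far_commute)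
  have "ftrace n (f * ?s * g) = ftrace n ((f * ?s * g * ?r) * ?r')"
  proof (rule ftrace_cong)
    have "- ((f * ?s * g) * (?r * ?r - (1 + z * ?r))) \<in> hecke_ideal n"
      unfolding z_def using assms
      by (intro hecke_ideal_uminus hecke_ideal_mult_left hecke_quadratic cl) auto
    moreover have "f * ?s * g - (f * ?s * g * ?r) * ?r' = - ((f * ?s * g) * (?r * ?r - (1 + ?r * z)))"
      by (simp add: algebra_simps)
    ultimately show "f * ?s * g - (f * ?s * g * ?r) * ?r' \<in> hecke_ideal n"
      by (simp only: zc[of ?r])
  qed
  also have "\<dots> = ftrace n (?r' * (f * ?s * g * ?r))"
    using assms by (intro ftrace_commute cl) auto
  also have "\<dots> = ftrace n (f * ?s * ?r * (?s' * g))"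
  proof (rule ftrace_cong)
    \<comment> \<open>\<open>?r\<close> and \<open>?r'\<close> differ by the central
      \<open>z\<close>, so they have the same commutators. In
      \<open>?r' * ?s * ?r - ?s * ?r * ?s'\<close> the terms with \<open>z\<close> cancel, leaving
      the braid relation.\<close>
    have "(?r * f - f * ?r) * (?s * g * ?r) + - ((f * ?r' * ?s) * (?r * g - g * ?r))
        + - (f * (?s * ?r * ?s - ?r * ?s * ?r) * g) \<in> hecke_ideal n"
      using assms far
      by (intro hecke_ideal_add hecke_ideal_uminus hecke_ideal_mult hecke_ideal_mult_left
          hecke_ideal_mult_right hecke_braid cl) auto
    moreover have "z * (f * ?s * g * ?r) = f * z * ?s * g * ?r" "f * ?s * ?r * z * g = f * z * ?s * ?r * g"
      by (simp_all add: zc flip: mult.assoc)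
    ultimately show "?r' * (f * ?s * g * ?r) - f * ?s * ?r * (?s' * g) \<in> hecke_ideal n"
      by (simp add: algebra_simps)
  qed
  finally show ?thesis by (simp add: z_def)
qed

lemma ftrace_stabilization:
  assumes "1 \<le> j" "j \<le> n" "f \<in> carrier (free_alg j)" "g \<in> carrier (free_alg j)"
  shows "ftrace (n + 1) (f * fgen j * g) = R_a * ftrace n (f * g)"
  using assms(2,1,3,4)
\<comment> \<open>\<open>f\<close> and \<open>g\<close> must vary: the step replaces them by
  \<open>f * ?s\<close> and \<open>(?s - z) * g\<close>, whose letters go up to \<open>j\<close>,
  just what level \<open>Suc j\<close> admits.\<close>
proof (induction j arbitrary: f g rule: inc_induct)
  case base
  then show ?case by (rule ftrace_stabilization_last)
next
  case (step j)
  define z where "z = fconst (R_q - R_q_inv)"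
  let ?s = "fgen j"
  have cl: "f \<in> carrier (free_alg (Suc j))" "g \<in> carrier (free_alg (Suc j))"
    "?s \<in> carrier (free_alg (Suc j))" "z \<in> carrier (free_alg (Suc j))"
    using step free_alg_mono[of j "Suc j"] by (auto simp: z_def intro: fgen_closed fconst_closed)
  note cl = cl free_alg_mult free_alg_diff free_alg_one
  have "ftrace (n + 1) (f * ?s * g) = ftrace (n + 1) ((f * ?s) * fgen (Suc j) * ((?s - z) * g))"
    using ftrace_shift_crossing[of j "n + 1" f g] step by (simp add: z_def)
  also have "\<dots> = R_a * ftrace n ((f * ?s) * ((?s - z) * g))"
    by (rule step.IH) (intro cl | simp)+
  \<comment> \<open>\<open>?s * (?s - z)\<close> is \<open>1\<close> modulo the ideal of level
    \<open>n\<close>, since \<open>j < n\<close>.\<close>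
  also have "ftrace n ((f * ?s) * ((?s - z) * g)) = ftrace n (f * g)"
  proof (rule ftrace_cong)
    have sub: "x \<in> carrier (free_alg n)" if "x \<in> carrier (free_alg (Suc j))" for x
      using that free_alg_mono[of "Suc j" n] step by auto
    have "f * (?s * ?s - (1 + z * ?s)) * g \<in> hecke_ideal n"
      unfolding z_def using step by (intro hecke_ideal_mult hecke_quadratic sub cl) auto
    moreover have "f * (?s * ?s - (1 + ?s * z)) * g = f * ?s * ((?s - z) * g) - f * g"
      by (simp add: algebra_simps)
    moreover have "?s * z = z * ?s" by (simp add: z_def fconst_commute)
    ultimately show "f * ?s * ((?s - z) * g) - f * g \<in> hecke_ideal n" by simp
  qed
  finally show ?case .
qed

end

text \<open>Both traces are evaluated along the spanning set: the parameters fix them on constants,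
  stabilization sends a crossing one level down, and both vanish on the ideal.\<close>

lemma ftrace_unique:
  assumes "markov_trace \<tau>" "markov_trace \<tau>'"
    and one: "\<And>n. n \<ge> 1 \<Longrightarrow> \<tau>' n \<one>\<^bsub>hecke n\<^esub> = \<tau> n \<one>\<^bsub>hecke n\<^esub>"
    and "n \<ge> 1" "f \<in> carrier (free_alg n)"
  shows "markov_trace.ftrace \<tau>' n f = markov_trace.ftrace \<tau> n f"
proof -
  interpret T: markov_trace \<tau> by fact
  interpret T': markov_trace \<tau>' by fact
  show ?thesis
    using assms(4,5)
  proof (induction n arbitrary: f rule: less_induct)
    case (less n)
    from less.prems(2) free_alg_subset_hecke_span have "f \<in> hecke_span n" by blast
    then show ?case
    proof (induction rule: hecke_span.induct)
      case (const c)
      then show ?case using less.prems one by (simp add: T.ftrace_const T'.ftrace_const)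
    next
      case (crossing j f g)
      \<comment> \<open>A crossing forces \<open>n\<close> to be at least 2, so the level
        \<open>m\<close> below is at least 1 and the induction hypothesis applies.\<close>
      then obtain m where m: "n = m + 1" "1 \<le> j" "j \<le> m"
        by (cases n) auto
      have "f * g \<in> carrier (free_alg m)"
        using crossing m free_alg_mono[of j m] by (auto intro: free_alg_mult)
      then show ?case
        using crossing m less.IH[of m "f * g"]
        by (simp add: T.ftrace_stabilization T'.ftrace_stabilization del: One_nat_def add_Suc_right)
    next
      case (ideal x)
      \<comment> \<open>Zero is written as \<open>fconst 0\<close>, so that
        \<open>ftrace_const\<close> gives the value \<open>0\<close> for both traces.\<close>
      have "T.ftrace n x = T.ftrace n (fconst 0)" "T'.ftrace n x = T'.ftrace n (fconst 0)"
        using ideal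
        by (auto simp: fconst_def intro: T.ftrace_cong T'.ftrace_cong)
      then show ?case
        using less.prems one by (simp add: T.ftrace_const T'.ftrace_const)
    next
      case (add x y)
      then show ?case
        using less.prems hecke_span_closed by (simp add: T.ftrace_add T'.ftrace_add)
    qed
  qed
qed


section \<open>Descending products\<close>

text \<open>For \<open>1 \<le> i\<close>, a common representative of \<open>hecke_desc n k i\<close>
  for all \<open>n > k\<close>.\<close>

definition fdesc :: "nat \<Rightarrow> nat \<Rightarrow> falg"
  where "fdesc k i = foldr (\<lambda>j x. fgen j * x) (rev [i..<Suc k]) 1"

text \<open>For \<open>i = Suc k\<close> the remaining product is empty and equals \<open>1\<close>;
  this is the boundary case of the recursion formula.\<close>

lemma fdesc_Suc: "i \<le> Suc k \<Longrightarrow> fdesc (Suc k) i = fgen (Suc k) * fdesc k i"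
  by (simp add: fdesc_def)

lemma fdesc_closed:
  assumes "1 \<le> i" "k < n"
  shows "fdesc k i \<in> carrier (free_alg n)"
proof -
  have "foldr (\<lambda>j x. fgen j * x) l 1 \<in> carrier (free_alg n)" if "set l \<subseteq> {1..<n}" for l
    using that by (induction l) (auto intro!: free_alg_one free_alg_mult fgen_closed)
  then show ?thesis
    unfolding fdesc_def using assms by (auto simp del: upt_Suc)
qed

lemma hecke_desc_eq:
  assumes "1 \<le> i" "k < n"
  shows "hecke_desc n k i = hecke_class n (fdesc k i)"
proof -
  have "foldr (\<lambda>j x. fgen j * x) l 1 \<in> carrier (free_alg n) \<and>
      foldr (\<lambda>j x. hecke_gen n j \<otimes>\<^bsub>hecke n\<^esub> x) l \<one>\<^bsub>hecke n\<^esub>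
        = hecke_class n (foldr (\<lambda>j x. fgen j * x) l 1)"
    if "set l \<subseteq> {1..<n}" for l
    using that
    by (induction l)
      (auto simp: hecke_one hecke_gen_def hecke_class_mult fgen_closed free_alg_one free_alg_mult)
  then show ?thesis
    unfolding fdesc_def hecke_desc_def using assms by (simp del: upt_Suc)
qed

lemma hecke_emb_closed:
  assumes "m \<le> n" "x \<in> carrier (hecke m)"
  shows "hecke_emb n x \<in> carrier (hecke n)"
  using assms free_alg_mono[of m n]
  by (auto elim!: hecke_carrierE simp: hecke_emb_coset intro!: hecke_class_closed)

lemma hecke_basis_closed: "hecke_basis n \<subseteq> carrier (hecke n)"
proof (induction n rule: hecke_basis.induct)
  case (3 m)
  interpret ring "hecke (Suc (Suc m))" by (rule hecke_is_ring)
  show ?case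
    using "3.IH"[OF refl] hecke_emb_closed[of "Suc m" "Suc (Suc m)"]
    by (auto simp: Let_def hecke_desc_eq intro!: m_closed hecke_class_closed fdesc_closed)
qed (simp_all add: hecke_one hecke_class_closed free_alg_one)

theorem theorem3p1:
  fixes \<tau> :: "nat \<Rightarrow> falg set \<Rightarrow> coeff_ring"
  assumes "transverse_markov_trace \<tau>"
  shows
    "(\<forall>\<tau>'. transverse_markov_trace \<tau>' \<longrightarrow>
        (\<forall>n \<ge> 1. \<tau>' n \<one>\<^bsub>hecke n\<^esub> = \<tau> n \<one>\<^bsub>hecke n\<^esub>) \<longrightarrow>
        (\<forall>n \<ge> 1. \<forall>x \<in> carrier (hecke n). \<tau>' n x = \<tau> n x)) \<and>
     (\<forall>n \<ge> 1. \<forall>k \<in> {1..n}. \<forall>i \<in> {1..k}. \<forall>u \<in> hecke_basis k.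
        \<tau> (n + 1) (hecke_emb (n + 1) u \<otimes>\<^bsub>hecke (n + 1)\<^esub> hecke_desc (n + 1) k i)
          = R_a * \<tau> n (hecke_emb n u \<otimes>\<^bsub>hecke n\<^esub> hecke_desc n (k - 1) i))"
proof -
  interpret T: markov_trace \<tau> using assms by unfold_locales
  show ?thesis
  proof (intro conjI allI impI ballI)
    fix \<tau>' n x
    assume *: "transverse_markov_trace \<tau>'" "\<forall>n \<ge> 1. \<tau>' n \<one>\<^bsub>hecke n\<^esub> = \<tau> n \<one>\<^bsub>hecke n\<^esub>"
      "1 \<le> n" "x \<in> carrier (hecke n)"
    interpret T': markov_trace \<tau>' using *(1) by unfold_locales
    obtain f where f: "f \<in> carrier (free_alg n)" "x = hecke_class n f"
      using *(4) by (rule hecke_carrierE)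
    show "\<tau>' n x = \<tau> n x"
      using ftrace_unique[OF T.markov_trace_axioms T'.markov_trace_axioms _ *(3) f(1)] *(2) f(2)
      by (simp add: T.ftrace_def T'.ftrace_def)
  next
    fix n k i u
    assume *: "1 \<le> n" "k \<in> {1..n}" "i \<in> {1..k}" "u \<in> hecke_basis k"
    obtain f where f: "f \<in> carrier (free_alg k)" "u = hecke_class k f"
      using hecke_basis_closed *(4) by (blast elim: hecke_carrierE)
    \<comment> \<open>Splitting off \<open>fgen k\<close> leaves \<open>fdesc l i\<close>, with
      letters below \<open>k\<close>. The product is thus a crossing at \<open>k\<close>, and
      \<open>ftrace_stabilization\<close> yields the recursion.\<close>
    obtain l where l: "k = Suc l" using * by (cases k) auto
    have d: "fdesc l i \<in> carrier (free_alg k)" "fdesc k i = fgen k * fdesc l i"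
      using * l by (auto intro: fdesc_closed fdesc_Suc)
    have "f \<in> carrier (free_alg n)" "f \<in> carrier (free_alg (n + 1))"
      using f * free_alg_mono[of k n] free_alg_mono[of k "n + 1"] by auto
    then have "hecke_emb (n + 1) u \<otimes>\<^bsub>hecke (n + 1)\<^esub> hecke_desc (n + 1) k i
        = hecke_class (n + 1) (f * fgen k * fdesc l i)"
      and "hecke_emb n u \<otimes>\<^bsub>hecke n\<^esub> hecke_desc n (k - 1) i = hecke_class n (f * fdesc l i)"
      using * f l fdesc_closed[of i k "n + 1"] fdesc_closed[of i l n]
      by (simp_all add: hecke_emb_coset hecke_desc_eq hecke_class_mult fdesc_Suc mult.assoc)
    then show "\<tau> (n + 1) (hecke_emb (n + 1) u \<otimes>\<^bsub>hecke (n + 1)\<^esub> hecke_desc (n + 1) k i)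
        = R_a * \<tau> n (hecke_emb n u \<otimes>\<^bsub>hecke n\<^esub> hecke_desc n (k - 1) i)"
      using T.ftrace_stabilization[of k n f "fdesc l i"] * f d by (simp add: T.ftrace_def)
  qed
qed

end
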